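(* Let $k\in\mathbb{N}$ and let $(p_0,p_1,\dots,p_k)\in\mathbb{N}^{k+1}$ with $p_k\neq 0$ be the shyness distribution of an audience. Consider the following program, which modifies the distribution $(p_0,\dots,p_k)$ and a counter $r$. Initialize $r\leftarrow 0$. For $s=1,2,\dots,k$ successively, perform one step: if the current values satisfy $\sum_{j=0}^{s-1}p_j<s$, then invite a friend with an arbitrarily chosen shyness level $s'\in\{0,1,\dots,s-1\}$, i.e. update $p_{s'}\leftarrow p_{s'}+1$ and $r\leftarrow r+1$; otherwise do nothing. After the step $s=k$, return $r$. Then, whatever choices of the levels $s'$ are made: the program terminates after exactly $k$ steps; once it terminates, the resulting audience (with the updated distribution) is $k$-soluble, and thus there will eventually be a standing ovation; and the returned value $r$ equals the least number of friends to invite, $r(p_0,p_1,\dots,p_k)$, where $(p_0,\dots,p_k)$ is the initial distribution.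
   Context: $\mathbb{N}=\{0,1,2,\dots\}$ and $[k]=\{0,1,\dots,k\}$; empty sums are $0$. Audience and standing ovation: an audience is a finite collection of spectators, each having a shyness level in $\mathbb{N}$; $p_s$ denotes the number of spectators with shyness level $s$. A spectator of shyness level $s$ stands up and applauds once (and only once) $s$ or more spectators are already up and applauding. Initially nobody is up. Formally, with $N_0=0$ and $N_{t+1}=\sum_{j\le N_t}p_j$ (the number of spectators up after round $t+1$), there is eventually a standing ovation iff $N_t$ equals the total number of spectators for some $t$. Solubility: for a distribution $(p_0,\dots,p_k)$ and $s\in[k]$, the audience is $s$-insoluble if there is $s'\in[s]$ with $\sum_{j=0}^{s'-1}p_j<s'$; otherwise it is $s$-soluble. Least number of friends: $r(p_0,\dots,p_k)$ is the least number of additional spectators ("friends"), with shyness levels in $\mathbb{N}$ chosen as one wishes, whose addition to an audience with distribution $(p_0,\dots,p_k)$ yields an audience in which there is eventually a standing ovation (every audience member, friends included, stands). *)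

theory Defs
  imports "HOL-Library.Multiset"
begin

text \<open>An audience is the finite multiset of the shyness levels of its spectators, so that
  \<^term>\<open>count p s\<close> is the number \<open>p\<^sub>s\<close> of spectators with shyness level \<open>s\<close>. A distribution
  \<open>(p\<^sub>0, \<dots>, p\<^sub>k)\<close> is an audience \<open>p\<close> with \<^term>\<open>set_mset p \<subseteq> {0..k}\<close>.\<close>

type_synonym audience = "nat multiset"

fun standing :: "audience \<Rightarrow> nat \<Rightarrow> nat" where
  "standing p 0 = 0"
| "standing p (Suc t) = (\<Sum>j\<le>standing p t. count p j)"

definition standing_ovation :: "audience \<Rightarrow> bool" where
  "standing_ovation p \<longleftrightarrow> (\<exists>t. standing p t = size p)"

definition insoluble :: "audience \<Rightarrow> nat \<Rightarrow> bool" where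
  "insoluble p s \<longleftrightarrow> (\<exists>s'\<in>{0..s}. (\<Sum>j<s'. count p j) < s')"

definition soluble :: "audience \<Rightarrow> nat \<Rightarrow> bool" where
  "soluble p s \<longleftrightarrow> \<not> insoluble p s"

definition least_friends :: "audience \<Rightarrow> nat" where
  "least_friends p = (LEAST n. \<exists>F :: audience. size F = n \<and> standing_ovation (p + F))"

text \<open>The minimum above ranges over a nonempty set.\<close>

lemma ex_friends: "\<exists>F :: audience. standing_ovation (p + F)"
proof -
  define m where "m = Max (insert 0 (set_mset p))"
  define q where "q = p + replicate_mset m 0"
  have le: "s \<le> m" if "s \<in># q" for s
  proof -
    have "s \<in> insert 0 (set_mset p)"
      using that by (auto simp: q_def split: if_splits)
    then show ?thesis
      unfolding m_def by (intro Max_ge) auto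
  qed
  have *: "(\<Sum>j\<le>n. count q j) = size q" if "m \<le> n" for n
    unfolding size_multiset_overloaded_eq
    by (rule sum.mono_neutral_right) (use le that in \<open>force simp: not_in_iff\<close>)+
  have "m \<le> standing q 1"
    by (simp add: q_def)
  then have "standing q (Suc 1) = size q"
    using * by (simp only: standing.simps(2))
  then show ?thesis
    unfolding standing_ovation_def q_def by blast
qed

text \<open>A state \<open>(s, p, r)\<close> of the program consists of the index \<open>s\<close> of the next step to be
  performed, the current audience \<open>p\<close> and the counter \<open>r\<close>. The relation is nondeterministic:
  the level \<open>s'\<close> of an invited friend is arbitrary, and may depend on the run so far.\<close>

type_synonym state = "nat \<times> audience \<times> nat"

inductive program_step :: "nat \<Rightarrow> state \<Rightarrow> state \<Rightarrow> bool" for k :: nat where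
  invite: "s \<le> k \<Longrightarrow> (\<Sum>j<s. count p j) < s \<Longrightarrow> s' < s \<Longrightarrow>
    program_step k (s, p, r) (Suc s, add_mset s' p, r + 1)"
| skip: "s \<le> k \<Longrightarrow> \<not> (\<Sum>j<s. count p j) < s \<Longrightarrow>
    program_step k (s, p, r) (Suc s, p, r)"

definition initial :: "audience \<Rightarrow> state" where
  "initial p = (1, p, 0)"

definition terminated :: "nat \<Rightarrow> state \<Rightarrow> bool" where
  "terminated k S \<longleftrightarrow> (\<nexists>S'. program_step k S S')"

end

theory Submission
  imports Defs
begin

text \<open>The standing crowd is stuck below \<open>m\<close> as soon as fewer than \<open>m\<close> spectators have a level below
  \<open>m\<close>; hence solubility up to the largest level is equivalent to a standing ovation. Before step
  \<open>s\<close> at least \<open>s - 1\<close> spectators have a level below \<open>s - 1\<close>, so an invited friend brings the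
  number below \<open>s\<close> to exactly \<open>s\<close>. As all friends invited so far have a level below \<open>s\<close>, the
  counter \<open>r\<close> is then exactly the deficit \<open>s - (p\<^sub>0 + \<dots> + p\<^bsub>s-1\<^esub>)\<close> of the initial audience, and any
  set of friends that leads to an ovation has to make up for this deficit.\<close>

text \<open>The filtered multiset makes additivity over \<open>+\<close> and comparison with
  \<open>size\<close> available to the simplifier.\<close>

lemma sum_count_lessThan:
  fixes p :: "nat multiset"
  shows "(\<Sum>j<m. count p j) = size (filter_mset (\<lambda>x. x < m) p)"
proof (induction p)
  case (add x p)
  have "(\<Sum>j<m. count (add_mset x p) j) = (\<Sum>j<m. (if j = x then 1 else 0) + count p j)"
    by (intro sum.cong) auto
  then show ?case
    using add by (simp add: sum.distrib)
qed simp

lemma soluble_iff: "soluble p s \<longleftrightarrow> (\<forall>m\<le>s. m \<le> (\<Sum>j<m. count p j))"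
  unfolding soluble_def insoluble_def by (auto simp: not_less)

lemma standing_Suc_lessThan: "standing p (Suc t) = (\<Sum>j<Suc (standing p t). count p j)"
  by (simp add: lessThan_Suc_atMost)

lemma sum_count_mono:
  fixes p :: "nat multiset"
  shows "m \<le> n \<Longrightarrow> (\<Sum>j<m. count p j) \<le> (\<Sum>j<n. count p j)"
  by (rule sum_mono2) auto

text \<open>If fewer than \<open>m\<close> spectators are up, the next round reaches only levels
  \<le> \<open>standing p t\<close> < \<open>m\<close>, so the bound reproduces itself.\<close>

lemma standing_le_if_deficit:
  assumes "(\<Sum>j<m. count p j) < m"
  shows "standing p t \<le> (\<Sum>j<m. count p j)"
proof (induction t)
  case (Suc t)
  then have "Suc (standing p t) \<le> m"
    using assms by simp
  then show ?case
    unfolding standing_Suc_lessThan by (rule sum_count_mono)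
qed simp

text \<open>Asking that \<open>k\<close> occurs, rather than that it is the largest level, makes
  this applicable to \<open>p + F\<close> with friends of arbitrary levels.\<close>

lemma standing_ovation_imp_soluble:
  assumes "standing_ovation p" "k \<in># p"
  shows "soluble p k"
  unfolding soluble_iff
proof (intro allI impI, rule ccontr)
  fix m assume m: "m \<le> k" "\<not> m \<le> (\<Sum>j<m. count p j)"
  obtain t where t: "standing p t = size p"
    using assms(1) unfolding standing_ovation_def by blast
  \<comment> \<open>A spectator of level \<open>k\<close> \<ge> \<open>m\<close> is lost by the
    filter, so a crowd stuck below \<open>m\<close> misses somebody.\<close>
  have "filter_mset (\<lambda>x. x < m) p \<noteq> p"
    using m(1) assms(2) by (auto simp: filter_mset_eq_conv not_less)
  then have "size (filter_mset (\<lambda>x. x < m) p) < size p"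
    by (intro mset_subset_size) (simp add: subset_mset.less_le)
  then show False
    using standing_le_if_deficit[of p m t] m(2) t by (simp add: sum_count_lessThan)
qed

lemma soluble_imp_standing_ovation:
  assumes sol: "soluble p k" and sub: "set_mset p \<subseteq> {0..k}"
  shows "standing_ovation p"
proof -
  \<comment> \<open>After \<open>k\<close> rounds at least \<open>k\<close> spectators are up; one
    further round then raises every level up to \<open>k\<close>.\<close>
  have "t \<le> k \<Longrightarrow> t \<le> standing p t" for t
  proof (induction t)
    case (Suc t)
    then have "Suc t \<le> (\<Sum>j<Suc t. count p j)"
      using sol unfolding soluble_iff by blast
    also have "\<dots> \<le> standing p (Suc t)"
      unfolding standing_Suc_lessThan using Suc by (intro sum_count_mono) simp
    finally show ?case .
  qed simp
  then have "k \<le> standing p k"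
    by simp
  then have "filter_mset (\<lambda>x. x < Suc (standing p k)) p = p"
    using sub by (auto simp: filter_mset_eq_conv)
  then have "standing p (Suc k) = size p"
    unfolding standing_Suc_lessThan sum_count_lessThan by simp
  then show ?thesis
    unfolding standing_ovation_def by blast
qed

lemma terminated_iff: "terminated k (s, p, r) \<longleftrightarrow> k < s"
proof
  assume t: "terminated k (s, p, r)"
  show "k < s"
  proof (rule ccontr)
    assume "\<not> k < s"
    then show False
      \<comment> \<open>Level 0 is an admissible choice for the friend, since a deficit at
        \<open>s\<close> forces 0 < \<open>s\<close>.\<close>
      using t program_step.invite[of s k p 0 r] program_step.skip[of s k p r]
      unfolding terminated_def by (cases "(\<Sum>j<s. count p j) < s") auto
  qed
qed (auto simp: terminated_def elim: program_step.cases)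

lemma program_run_index:
  assumes "(program_step k ^^ n) (initial p) S"
  shows "fst S = Suc n \<and> n \<le> k"
  using assms
proof (induction n arbitrary: S)
  case (Suc n)
  then obtain S' where "(program_step k ^^ n) (initial p) S'" and step: "program_step k S' S"
    by auto
  then have "fst S' = Suc n"
    using Suc.IH by blast
  with step show ?case
    by (cases rule: program_step.cases) auto
qed (simp add: initial_def)

text \<open>The last clause certifies optimality by a deficit of the initial audience
  \<open>p\<close>. Its \<open>m\<close> can be kept when a step is skipped and becomes the current
  index at an invitation.\<close>

definition program_invariant :: "nat \<Rightarrow> audience \<Rightarrow> state \<Rightarrow> bool" where
  "program_invariant k p = (\<lambda>(s, q, r). 0 < s \<and> s \<le> Suc k \<and> (\<forall>m<s. m \<le> (\<Sum>j<m. count q j)) \<and>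
     (\<exists>G. q = p + G \<and> size G = r \<and> set_mset G \<subseteq> {..<s}) \<and>
     (\<exists>m\<le>k. r \<le> m - (\<Sum>j<m. count p j)))"

lemma program_invariant_step:
  assumes "program_step k S T" "program_invariant k p S"
  shows "program_invariant k p T"
  using assms
proof (cases rule: program_step.cases)
  case (invite s q s' r)
  have inv: "0 < s" "\<forall>m<s. m \<le> (\<Sum>j<m. count q j)"
    using assms(2) unfolding invite program_invariant_def by auto
  obtain G where G: "q = p + G" "size G = r" "set_mset G \<subseteq> {..<s}"
    using assms(2) unfolding invite program_invariant_def by auto
  let ?q = "add_mset s' q"
  have "s - 1 \<le> (\<Sum>j<s - 1. count q j)"
    using inv by simp
  also have "\<dots> \<le> (\<Sum>j<s. count q j)"
    by (rule sum_count_mono) simp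
  finally have exact: "Suc (\<Sum>j<s. count q j) = s"
    using invite inv(1) by linarith
  have Suc_sum: "(\<Sum>j<s. count ?q j) = Suc (\<Sum>j<s. count q j)"
    using invite unfolding sum_count_lessThan by simp
  have soluble: "m \<le> (\<Sum>j<m. count ?q j)" if "m < Suc s" for m
  proof (cases "m = s")
    case False
    then have "m \<le> (\<Sum>j<m. count q j)"
      using that inv(2) by simp
    also have "\<dots> \<le> (\<Sum>j<m. count ?q j)"
      by (intro sum_mono) simp
    finally show ?thesis .
  qed (use exact Suc_sum in simp)
  \<comment> \<open>All earlier friends are counted below \<open>s\<close>, so the deficits of
    \<open>p\<close> and \<open>q\<close> at \<open>s\<close> differ by exactly \<open>r\<close>;
    that of \<open>q\<close> is 1.\<close>
  have "filter_mset (\<lambda>x. x < s) G = G"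
    using G(3) by (auto simp: filter_mset_eq_conv)
  then have "(\<Sum>j<s. count q j) = (\<Sum>j<s. count p j) + r"
    unfolding sum_count_lessThan using G by simp
  then have "r + 1 \<le> s - (\<Sum>j<s. count p j)"
    using exact by simp
  moreover have "\<exists>H. ?q = p + H \<and> size H = r + 1 \<and> set_mset H \<subseteq> {..<Suc s}"
    using G invite by (intro exI[of _ "add_mset s' G"]) auto
  ultimately show ?thesis
    using soluble invite unfolding program_invariant_def by auto
next
  case (skip s q r)
  \<comment> \<open>The failed guard is the new instance \<open>m = s\<close> of the solubility
    clause; \<open>G\<close> and the certificate carry over.\<close>
  then show ?thesis
    using assms(2) unfolding program_invariant_def by (fastforce simp: less_Suc_eq not_less)
qed

lemma program_invariant_reachable:
  assumes "(program_step k)\<^sup>*\<^sup>* (initial p) S"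
  shows "program_invariant k p S"
  using assms
proof (induction rule: rtranclp_induct)
  case base
  show ?case
    unfolding program_invariant_def initial_def by auto
qed (use program_invariant_step in blast)

text \<open>\<open>p + F\<close> must be soluble up to \<open>k\<close>, and each friend adds at
  most one to the number of spectators below \<open>m\<close>.\<close>

lemma deficit_le_friends:
  assumes "standing_ovation (p + F)" "k \<in># p" "m \<le> k"
  shows "m - (\<Sum>j<m. count p j) \<le> size F"
proof -
  have "soluble (p + F) k"
    using assms by (intro standing_ovation_imp_soluble) auto
  then have "m \<le> (\<Sum>j<m. count (p + F) j)"
    using assms(3) unfolding soluble_iff by blast
  also have "\<dots> \<le> (\<Sum>j<m. count p j) + size F"
    by (simp add: sum_count_lessThan size_filter_mset_lesseq del: count_union)
  finally show ?thesis
    by simp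
qed

theorem theorem2:
  fixes k :: nat and p :: audience
  assumes "set_mset p \<subseteq> {0..k}" and "count p k \<noteq> 0"
  shows "(\<forall>n S. (program_step k ^^ n) (initial p) S \<longrightarrow>
            n \<le> k \<and> (terminated k S \<longleftrightarrow> n = k)) \<and>
         (\<forall>s p' r. (program_step k)\<^sup>*\<^sup>* (initial p) (s, p', r) \<and> terminated k (s, p', r) \<longrightarrow>
            soluble p' k \<and> standing_ovation p' \<and> r = least_friends p)"
proof (intro conjI allI impI)
  fix n S assume "(program_step k ^^ n) (initial p) S"
  then have index: "fst S = Suc n \<and> n \<le> k"
    by (rule program_run_index)
  then show "n \<le> k"
    by simp
  show "terminated k S \<longleftrightarrow> n = k"
    using index by (cases S) (auto simp: terminated_iff)
next
  fix s q r
  assume run: "(program_step k)\<^sup>*\<^sup>* (initial p) (s, q, r) \<and> terminated k (s, q, r)"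
  then have inv: "program_invariant k p (s, q, r)"
    using program_invariant_reachable by blast
  have s: "s = Suc k"
    using run inv unfolding terminated_iff program_invariant_def by auto
  show sol: "soluble q k"
    using inv unfolding s program_invariant_def soluble_iff by auto
  obtain G where G: "q = p + G" "size G = r" "set_mset G \<subseteq> {..<Suc k}"
    using inv unfolding s program_invariant_def by auto
  show ov: "standing_ovation q"
    using sol by (rule soluble_imp_standing_ovation) (use G assms(1) in auto)
  obtain m where m: "m \<le> k" "r \<le> m - (\<Sum>j<m. count p j)"
    using inv unfolding program_invariant_def by auto
  show "r = least_friends p"
    unfolding least_friends_def
  proof (rule Least_equality[symmetric])
    show "\<exists>F. size F = r \<and> standing_ovation (p + F)"
      using G ov by blast
  next
    fix n assume "\<exists>F. size F = n \<and> standing_ovation (p + F)"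
    then obtain F where "size F = n" "standing_ovation (p + F)"
      by blast
    then show "r \<le> n"
      using deficit_le_friends[of p F k m] m assms(2) by simp
  qed
qed

end
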